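(* Let $L$ be a modular, l.f.f.c. lattice with dissection skeleton $S$. Then $L$ has a minimum element if and only if $S$ has a minimum element.
   Context: A lattice is l.f.f.c. if every closed interval is finite and every element has finitely many upper covers and finitely many lower covers. For $x\in L$, $x^*=x$ if $x$ is the top of $L$, otherwise $x^*$ is the join of all upper covers of $x$; dually $x_*=x$ if $x$ is the bottom of $L$, otherwise the meet of all lower covers of $x$. A block of $L$ is a maximal (under inclusion) complemented interval $B=[0_B,1_B]$ of $L$. The dissection skeleton $S$ is the set of blocks ordered by $B\le C$ iff $0_B\le 0_C$ (equivalently $1_B\le 1_C$); it is a lattice. *)

theory Defs
  imports Main
begin

class modular_lattice = lattice +
  assumes modular_law: "x \<le> z \<Longrightarrow> sup x (inf y z) = inf (sup x y) z"

definition (in order) upper_covers :: "'a \<Rightarrow> 'a set" where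
  "upper_covers x = {y. x < y \<and> \<not> (\<exists>z. x < z \<and> z < y)}"

definition (in order) lower_covers :: "'a \<Rightarrow> 'a set" where
  "lower_covers x = {y. y < x \<and> \<not> (\<exists>z. y < z \<and> z < x)}"

text \<open>``l.f.f.c.'': locally finite with finite covers. No top or bottom element is assumed.\<close>

class lffc_lattice = lattice +
  assumes finite_interval: "finite {x..y}"
    and finite_upper_covers: "finite (upper_covers x)"
    and finite_lower_covers: "finite (lower_covers x)"

text \<open>
  Intervals are represented by their underlying sets and are nonempty (\<open>a \<le> b\<close>).
  Complements are relative to the bounds of the interval.
\<close>

definition complemented_interval :: "'a::lattice set \<Rightarrow> bool" where
  "complemented_interval B \<longleftrightarrow>
     (\<exists>a b. a \<le> b \<and> B = {a..b} \<and> (\<forall>x\<in>{a..b}. \<exists>y\<in>{a..b}. inf x y = a \<and> sup x y = b))"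

definition block :: "'a::lattice set \<Rightarrow> bool" where
  "block B \<longleftrightarrow>
     complemented_interval B \<and> (\<forall>C. complemented_interval C \<longrightarrow> B \<subseteq> C \<longrightarrow> C = B)"

text \<open>\<open>zero_of B\<close> is \<open>0\<^sub>B\<close>; it is meaningful when \<open>B\<close> is an interval.\<close>

definition zero_of :: "'a::lattice set \<Rightarrow> 'a" where
  "zero_of B = (LEAST x. x \<in> B)"

lemma zero_of_interval [simp]: "a \<le> b \<Longrightarrow> zero_of {a..b} = a"
  unfolding zero_of_def by (rule Least_equality) auto

text \<open>The dissection skeleton is the set \<open>skeleton\<close> ordered by the relation \<open>skeleton_le\<close>.\<close>

definition skeleton :: "'a::lattice set set" where
  "skeleton = {B. block B}"

definition skeleton_le :: "'a::lattice set \<Rightarrow> 'a set \<Rightarrow> bool" where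
  "skeleton_le B C \<longleftrightarrow> zero_of B \<le> zero_of C"

end

theory Submission
  imports Defs
begin

text \<open>
  Every element \<open>x\<close> lies in a block. By modularity, a complemented interval \<open>[a, b]\<close>
  containing \<open>x\<close> restricts to complemented intervals \<open>[a, x]\<close> and \<open>[x, b]\<close>, which forces
  \<open>x\<^sub>* \<le> a\<close> and \<open>b \<le> x\<^sup>*\<close>; so all these intervals lie in the finite interval \<open>[x\<^sub>*, x\<^sup>*]\<close>,
  and a maximal one above \<open>[x, x]\<close> is a block. Hence the zero of a least block is below every
  element, and conversely a block containing a least element of the lattice has it as its zero.
\<close>

text \<open>A nonempty interval determines its endpoints, so the bounds bound existentially in the
  definition can only be \<open>a\<close> and \<open>b\<close>.\<close>

lemma complemented_interval_iff:
  assumes "a \<le> b"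
  shows "complemented_interval {a..b} \<longleftrightarrow>
    (\<forall>x\<in>{a..b}. \<exists>y\<in>{a..b}. inf x y = a \<and> sup x y = b)"
proof
  assume "complemented_interval {a..b}"
  then obtain c d where "c \<le> d" "{a..b} = {c..d}"
    "\<forall>x\<in>{c..d}. \<exists>y\<in>{c..d}. inf x y = c \<and> sup x y = d"
    unfolding complemented_interval_def by blast
  then show "\<forall>x\<in>{a..b}. \<exists>y\<in>{a..b}. inf x y = a \<and> sup x y = b"
    using assms by (metis Icc_eq_Icc)
qed (use assms in \<open>auto simp: complemented_interval_def\<close>)

lemma complemented_intervalE:
  assumes "complemented_interval B"
  obtains a b where "a \<le> b" "B = {a..b}"
  using assms unfolding complemented_interval_def by blast

lemma complemented_interval_complementE:
  assumes "complemented_interval {a..b}" "x \<in> {a..b}"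
  obtains y where "a \<le> y" "y \<le> b" "inf x y = a" "sup x y = b"
proof -
  have "a \<le> b"
    using assms(2) order_trans by auto
  then show ?thesis
    using assms that complemented_interval_iff[of a b] by (metis atLeastAtMost_iff)
qed

text \<open>If \<open>z\<close> complements \<open>y\<close> in \<open>{a..b}\<close>, then
  \<open>sup x z\<close> complements \<open>y\<close> in \<open>{x..b}\<close>: since
  \<open>x \<le> y\<close>, modularity moves the join with \<open>x\<close> out of the meet with
  \<open>y\<close>, leaving \<open>sup x a = x\<close>.\<close>

lemma complemented_interval_upper_part:
  fixes x :: "'a::modular_lattice"
  assumes "complemented_interval {a..b}" "a \<le> x" "x \<le> b"
  shows "complemented_interval {x..b}"
proof -
  have "\<exists>z\<in>{x..b}. inf y z = x \<and> sup y z = b" if "y \<in> {x..b}" for y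
  proof -
    have "y \<in> {a..b}"
      using assms(2,3) that order_trans by auto
    then obtain z where z: "a \<le> z" "z \<le> b" "inf y z = a" "sup y z = b"
      using assms(1) complemented_interval_complementE by blast
    have "inf y (sup x z) = sup x (inf y z)"
      using that modular_law[of x y z] by (simp add: inf.commute)
    also have "\<dots> = x"
      using z(3) assms(2) by (simp add: sup.absorb1)
    finally have "inf y (sup x z) = x" .
    moreover have "sup y (sup x z) = b"
      using that z(4) by (metis atLeastAtMost_iff sup.absorb1 sup.assoc)
    ultimately show ?thesis
      using assms(3) z(2) by (intro bexI[of _ "sup x z"]) auto
  qed
  then show ?thesis
    using assms by (subst complemented_interval_iff) auto
qed

text \<open>Dually, a complement \<open>z\<close> of \<open>y\<close> in \<open>{a..b}\<close> is
  cut down to \<open>inf z x\<close>; modularity applies because \<open>y \<le> x\<close>.\<close>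

lemma complemented_interval_lower_part:
  fixes x :: "'a::modular_lattice"
  assumes "complemented_interval {a..b}" "a \<le> x" "x \<le> b"
  shows "complemented_interval {a..x}"
proof -
  have "\<exists>z\<in>{a..x}. inf y z = a \<and> sup y z = x" if "y \<in> {a..x}" for y
  proof -
    have "y \<in> {a..b}"
      using assms(2,3) that order_trans by auto
    then obtain z where z: "a \<le> z" "z \<le> b" "inf y z = a" "sup y z = b"
      using assms(1) complemented_interval_complementE by blast
    have "sup y (inf z x) = inf (sup y z) x"
      using that by (intro modular_law) auto
    also have "\<dots> = x"
      using z(4) assms(3) by (simp add: inf.absorb2)
    finally have "sup y (inf z x) = x" .
    moreover have "inf y (inf z x) = a"
      using that z(3) by (metis atLeastAtMost_iff inf.absorb1 inf.assoc inf.commute)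
    ultimately show ?thesis
      using assms(2) z(1) by (intro bexI[of _ "inf z x"]) auto
  qed
  then show ?thesis
    using assms by (subst complemented_interval_iff) auto
qed

text \<open>A minimal element \<open>p\<close> of the finite set \<open>{x<..y}\<close> covers
  \<open>x\<close> in the whole lattice, because anything strictly between \<open>x\<close> and
  \<open>p\<close> would again lie in that set.\<close>

lemma upper_cover_below:
  fixes x :: "'a::lffc_lattice"
  assumes "x < y"
  obtains p where "p \<in> upper_covers x" "p \<le> y"
proof -
  have "finite {x<..y}"
    by (rule finite_subset[OF _ finite_interval[of x y]]) auto
  then obtain p where "p \<in> {x<..y}" "\<forall>z\<in>{x<..y}. z \<le> p \<longrightarrow> p = z"
    using finite_has_minimal[of "{x<..y}"] assms by auto
  then have "p \<in> upper_covers x"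
    unfolding upper_covers_def
    by (auto, metis leD less_imp_le order.trans greaterThanAtMost_iff)
  with \<open>p \<in> {x<..y}\<close> show ?thesis
    using that by auto
qed

lemma lower_cover_above:
  fixes x :: "'a::lffc_lattice"
  assumes "y < x"
  obtains p where "p \<in> lower_covers x" "y \<le> p"
proof -
  have "finite {y..<x}"
    by (rule finite_subset[OF _ finite_interval[of y x]]) auto
  then obtain p where "p \<in> {y..<x}" "\<forall>z\<in>{y..<x}. p \<le> z \<longrightarrow> p = z"
    using finite_has_maximal[of "{y..<x}"] assms by auto
  then have "p \<in> lower_covers x"
    unfolding lower_covers_def
    by (auto, metis leD less_imp_le order.trans atLeastLessThan_iff)
  with \<open>p \<in> {y..<x}\<close> show ?thesis
    using that by auto
qed

text \<open>The part of this join below \<open>b\<close> already meets every element of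
  \<open>{a..b}\<close> other than \<open>a\<close> above \<open>a\<close>, since each of these lies
  above an upper cover of \<open>a\<close>. Hence its complement is \<open>a\<close>, and it equals
  \<open>b\<close>.\<close>

lemma complemented_interval_le_Sup_upper_covers:
  fixes a :: "'a::lffc_lattice"
  assumes "complemented_interval {a..b}" "a \<le> b"
  shows "b \<le> Sup_fin (insert a (upper_covers a))"
proof -
  \<comment> \<open>Inserting \<open>a\<close> keeps the set nonempty, as \<open>Sup_fin\<close>
    requires. It leaves the join of existing covers unchanged and gives \<open>a\<close> itself when
    \<open>a\<close> is the top, so \<open>?s\<close> is \<open>a\<^sup>*\<close>.\<close>
  let ?s = "Sup_fin (insert a (upper_covers a))"
  have le: "p \<le> ?s" if "p \<in> insert a (upper_covers a)" for p
    using that finite_upper_covers by (intro Sup_fin.coboundedI) auto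
  have "inf ?s b \<in> {a..b}"
    using le[of a] assms(2) by (simp del: Sup_fin.insert)
  then obtain t where t: "a \<le> t" "t \<le> b" "inf (inf ?s b) t = a" "sup (inf ?s b) t = b"
    using assms(1) complemented_interval_complementE by blast
  have "t = a"
  proof (rule ccontr)
    assume "t \<noteq> a"
    then obtain p where p: "p \<in> upper_covers a" "p \<le> t"
      using t(1) upper_cover_below[of a t] by force
    \<comment> \<open>The cover \<open>p\<close> is below \<open>?s\<close> by construction and
      below \<open>t\<close>, hence below \<open>b\<close>; so it would lie below the meet of two
      complements, which is \<open>a\<close>.\<close>
    then have "p \<le> inf (inf ?s b) t"
      using le[of p] t(2) order_trans[of p t b] by (simp del: Sup_fin.insert)
    then have "p \<le> a"
      unfolding t(3) .
    then show False
      using p(1) unfolding upper_covers_def by (auto dest: leD)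
  qed
  then have "inf ?s b = b"
    using t(4) \<open>inf ?s b \<in> {a..b}\<close> by (simp add: sup.absorb1 del: Sup_fin.insert)
  then show ?thesis
    by (simp only: inf.absorb_iff2)
qed

text \<open>Order dual of the previous bound: a complement of \<open>sup ?s a\<close> other than
  \<open>b\<close> would lie below a lower cover of \<open>b\<close>, which is also above
  \<open>?s\<close>, so the two could not join to \<open>b\<close>.\<close>

lemma Inf_lower_covers_le_complemented_interval:
  fixes a :: "'a::lffc_lattice"
  assumes "complemented_interval {a..b}" "a \<le> b"
  shows "Inf_fin (insert b (lower_covers b)) \<le> a"
proof -
  let ?s = "Inf_fin (insert b (lower_covers b))"
  have le: "?s \<le> p" if "p \<in> insert b (lower_covers b)" for p
    using that finite_lower_covers by (intro Inf_fin.coboundedI) auto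
  have "sup ?s a \<in> {a..b}"
    using le[of b] assms(2) by (simp del: Inf_fin.insert)
  then obtain t where t: "a \<le> t" "t \<le> b" "inf (sup ?s a) t = a" "sup (sup ?s a) t = b"
    using assms(1) complemented_interval_complementE by blast
  have "t = b"
  proof (rule ccontr)
    assume "t \<noteq> b"
    then obtain p where p: "p \<in> lower_covers b" "t \<le> p"
      using t(2) lower_cover_above[of t b] by force
    then have "sup (sup ?s a) t \<le> p"
      using le[of p] t(1) order_trans[of a t p] by (simp del: Inf_fin.insert)
    then have "b \<le> p"
      unfolding t(4) .
    then show False
      using p(1) unfolding lower_covers_def by (auto dest: leD)
  qed
  then have "sup ?s a = a"
    using t(3) \<open>sup ?s a \<in> {a..b}\<close> by (simp add: inf.absorb1 del: Inf_fin.insert)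
  then show ?thesis
    by (simp only: sup.absorb_iff2)
qed

lemma ex_block_containing:
  fixes x :: "'a::{modular_lattice, lffc_lattice}"
  shows "\<exists>B. block B \<and> x \<in> B"
proof -
  let ?I = "{Inf_fin (insert x (lower_covers x))..Sup_fin (insert x (upper_covers x))}"
  let ?F = "{C. complemented_interval C \<and> x \<in> C}"
  have "C \<subseteq> ?I" if "C \<in> ?F" for C
  proof -
    obtain a b where C: "C = {a..b}"
      using \<open>C \<in> ?F\<close> complemented_intervalE by blast
    then have *: "complemented_interval {a..b}" "a \<le> x" "x \<le> b"
      using that by auto
    have "b \<le> Sup_fin (insert x (upper_covers x))"
      using complemented_interval_le_Sup_upper_covers complemented_interval_upper_part * by blast
    moreover have "Inf_fin (insert x (lower_covers x)) \<le> a"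
      using Inf_lower_covers_le_complemented_interval complemented_interval_lower_part * by blast
    ultimately show ?thesis
      unfolding C atLeastatMost_subset_iff by blast
  qed
  \<comment> \<open>All members of \<open>?F\<close> are subsets of the one finite interval
    \<open>?I\<close>.\<close>
  then have "finite ?F"
    by (intro finite_subset[of ?F "Pow ?I"]) (auto simp: finite_interval)
  moreover have "{x..x} \<in> ?F"
    using complemented_interval_iff[of x x] by simp
  ultimately obtain B where "B \<in> ?F" "\<forall>C\<in>?F. B \<subseteq> C \<longrightarrow> B = C"
    using finite_has_maximal[of ?F] by blast
  \<comment> \<open>Maximality within \<open>?F\<close> is maximality among all complemented
    intervals, since every superset of \<open>B\<close> still contains \<open>x\<close>.\<close>
  then show ?thesis
    unfolding block_def by blast
qed

lemma block_zero_of_le: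
  assumes "block B" "x \<in> B"
  shows "zero_of B \<le> x"
  using assms unfolding block_def by (auto elim!: complemented_intervalE)

theorem theorem5p23:
  shows "(\<exists>m::'a::{modular_lattice, lffc_lattice}. \<forall>x. m \<le> x) \<longleftrightarrow>
    (\<exists>B\<in>(skeleton :: 'a set set). \<forall>C\<in>skeleton. skeleton_le B C)"
proof
  assume "\<exists>m::'a. \<forall>x. m \<le> x"
  then obtain m :: 'a where m: "\<And>x. m \<le> x"
    by blast
  obtain B where B: "block B" "m \<in> B"
    using ex_block_containing by blast
  \<comment> \<open>\<open>zero_of B\<close> is below \<open>m\<close>, which is below
    everything.\<close>
  then have "zero_of B \<le> x" for x
    using block_zero_of_le m order_trans by blast
  with B show "\<exists>B\<in>(skeleton :: 'a set set). \<forall>C\<in>skeleton. skeleton_le B C"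
    by (auto simp: skeleton_def skeleton_le_def)
next
  assume "\<exists>B\<in>(skeleton :: 'a set set). \<forall>C\<in>skeleton. skeleton_le B C"
  then obtain B :: "'a set" where B: "\<And>C. block C \<Longrightarrow> zero_of B \<le> zero_of C"
    by (auto simp: skeleton_def skeleton_le_def)
  have "zero_of B \<le> x" for x
    using ex_block_containing[of x] B block_zero_of_le order_trans by blast
  then show "\<exists>m::'a. \<forall>x. m \<le> x"
    by blast
qed

end
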